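(* For $i=1,2$ let $G_i=(V_i,E_i)$ be a locally finite graph with a distinguished vertex $o_i\in V_i$. Let $\mu_i$ be the spectral distribution of the adjacency matrix $A^{(i)}$ of $G_i$ in the vector state at $o_i$. Assume that $\mu_i$ is symmetric, or equivalently that $W_{2m+1}(o_i;G_i)=0$ for all $m=0,1,2,\dots$ and $i=1,2$. Then we have \[ W_m((o_1,o_2);G_1\times_K G_2)=M_m(\mu_1*_M\mu_2),\qquad m=0,1,2,\dots. \] In other words, the spectral distribution of the Kronecker product $G_1\times_K G_2$ in the vector state at $(o_1,o_2)$ is the Mellin convolution of $\mu_1$ and $\mu_2$.
   Context: A graph $G=(V,E)$ consists of a non-empty (finite or infinite) set $V$ and a set $E$ of two-point subsets of $V$; $x\sim y$ means $\{x,y\}\in E$. All graphs are assumed locally finite, i.e. every vertex has finitely many adjacent vertices. The adjacency matrix $A$ of $G$ is indexed by $V\times V$ with $(A)_{xy}=1$ if $x\sim y$ and $(A)_{xy}=0$ otherwise. For $o\in V$, $W_m(o;G)=(A^m)_{oo}$ is the number of $m$-step walks from $o$ to itself, with $W_0(o;G)=1$. For a probability distribution $\mu$ on $\mathbb{R}$ with finite moments of all orders, $M_m(\mu)=\int_{\mathbb{R}}x^m\,\mu(dx)$ is its $m$-th moment. There exists a probability distribution $\mu$ on $\mathbb{R}$ such that $W_m(o;G)=(A^m)_{oo}=M_m(\mu)$ for all $m=0,1,2,\dots$; it is called the spectral distribution of $A$ (or of $G$) in the vector state at $o$. It is not uniquely determined in general, because of the indeterminate moment problem, but it is unique if the degrees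 of the vertices are uniformly bounded. If $W_{2m+1}(o;G)=0$ for all $m=0,1,2,\dots$, the spectral distribution may be assumed to be symmetric. A measure $\mu$ on $\mathbb{R}$ is called symmetric if $\mu(-dx)=\mu(dx)$. For symmetric probability distributions $\mu,\nu$ on $\mathbb{R}$ having finite moments of all orders, the Mellin convolution $\mu*_M\nu$ is the probability distribution uniquely specified by \[ \int_{\mathbb{R}}h(x)\,\mu*_M\nu(dx)=\int_{\mathbb{R}}\int_{\mathbb{R}}h(xy)\,\mu(dx)\,\nu(dy),\qquad h\in C_{\mathrm{bdd}}(\mathbb{R}), \] where $C_{\mathrm{bdd}}(\mathbb{R})$ denotes the bounded continuous functions on $\mathbb{R}$; it is symmetric and has finite moments of all orders. The Kronecker product $G_1\times_K G_2$ is the graph on $V_1\times V_2$ with $(x,y)\sim(x',y')$ if and only if $x\sim x'$ in $G_1$ and $y\sim y'$ in $G_2$. *)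

theory Defs
  imports "HOL-Probability.Probability"
begin

section \<open>Graphs and their adjacency matrices\<close>

record 'a ugraph =
  uverts :: "'a set"
  uedges :: "'a set set"

definition adjacent :: "'a ugraph \<Rightarrow> 'a \<Rightarrow> 'a \<Rightarrow> bool" where
  "adjacent G x y \<longleftrightarrow> {x, y} \<in> uedges G"

definition is_graph :: "'a ugraph \<Rightarrow> bool" where
  "is_graph G \<longleftrightarrow> uverts G \<noteq> {} \<and> (\<forall>e\<in>uedges G. e \<subseteq> uverts G \<and> card e = 2)"

definition locally_finite_graph :: "'a ugraph \<Rightarrow> bool" where
  "locally_finite_graph G \<longleftrightarrow>
     is_graph G \<and> (\<forall>x\<in>uverts G. finite {y \<in> uverts G. adjacent G x y})"

definition adj_matrix :: "'a ugraph \<Rightarrow> 'a \<Rightarrow> 'a \<Rightarrow> real" where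
  "adj_matrix G x y = (if adjacent G x y then 1 else 0)"

text \<open>
  Powers of a (possibly infinite) matrix with index set \<open>V\<close>. For the adjacency matrix of a
  locally finite graph, the sum has only finitely many non-zero terms.
\<close>

primrec matrix_power :: "'a set \<Rightarrow> ('a \<Rightarrow> 'a \<Rightarrow> real) \<Rightarrow> nat \<Rightarrow> 'a \<Rightarrow> 'a \<Rightarrow> real" where
  "matrix_power V A 0 = (\<lambda>x y. if x = y then 1 else 0)"
| "matrix_power V A (Suc m) = (\<lambda>x y. \<Sum>\<^sub>\<infinity>z\<in>V. matrix_power V A m x z * A z y)"

definition walks :: "nat \<Rightarrow> 'a \<Rightarrow> 'a ugraph \<Rightarrow> real" where
  "walks m v G = matrix_power (uverts G) (adj_matrix G) m v v"

definition kronecker_product :: "'a ugraph \<Rightarrow> 'b ugraph \<Rightarrow> ('a \<times> 'b) ugraph" where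
  "kronecker_product G H =
     \<lparr>uverts = uverts G \<times> uverts H,
      uedges = {{(x, y), (x', y')} | x y x' y'. adjacent G x x' \<and> adjacent H y y'}\<rparr>"

lemma adjacent_kronecker_product_iff:
  "adjacent (kronecker_product G H) (x, y) (x', y') \<longleftrightarrow> adjacent G x x' \<and> adjacent H y y'"
  unfolding adjacent_def kronecker_product_def
  by (auto simp: doubleton_eq_iff insert_commute)

section \<open>Probability distributions on the real line\<close>

definition finite_moments :: "real measure \<Rightarrow> bool" where
  "finite_moments \<mu> \<longleftrightarrow> (\<forall>m::nat. integrable \<mu> (\<lambda>x. x ^ m))"

definition moment :: "nat \<Rightarrow> real measure \<Rightarrow> real" where
  "moment m \<mu> = (LINT x|\<mu>. x ^ m)"

definition symmetric_measure :: "real measure \<Rightarrow> bool" where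
  "symmetric_measure \<mu> \<longleftrightarrow> distr \<mu> borel uminus = \<mu>"

definition is_mellin_convolution :: "real measure \<Rightarrow> real measure \<Rightarrow> real measure \<Rightarrow> bool" where
  "is_mellin_convolution \<mu> \<nu> \<rho> \<longleftrightarrow>
     real_distribution \<rho> \<and>
     (\<forall>h::real \<Rightarrow> real. continuous_on UNIV h \<longrightarrow> bounded (range h) \<longrightarrow>
        (LINT z|\<rho>. h z) = (LINT y|\<nu>. LINT x|\<mu>. h (x * y)))"

definition mellin_convolution :: "real measure \<Rightarrow> real measure \<Rightarrow> real measure" where
  "mellin_convolution \<mu> \<nu> = (THE \<rho>. is_mellin_convolution \<mu> \<nu> \<rho>)"

text \<open>
  This is a predicate because the spectral distribution need not be unique when the degrees
  of the graph are unbounded.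
\<close>

definition spectral_distribution :: "'a ugraph \<Rightarrow> 'a \<Rightarrow> real measure \<Rightarrow> bool" where
  "spectral_distribution G v \<mu> \<longleftrightarrow>
     real_distribution \<mu> \<and> finite_moments \<mu> \<and> (\<forall>m. walks m v G = moment m \<mu>)"

text \<open>The defining property of the Mellin convolution determines it uniquely.\<close>

lemma is_mellin_convolution_distr:
  assumes "real_distribution \<mu>" "real_distribution \<nu>"
  shows "is_mellin_convolution \<mu> \<nu> (distr (\<mu> \<Otimes>\<^sub>M \<nu>) borel (\<lambda>(x, y). x * y))"
proof -
  interpret mu: real_distribution \<mu> by fact
  interpret nu: real_distribution \<nu> by fact
  interpret P: pair_prob_space \<mu> \<nu> ..
  have M: "(\<lambda>(x, y). x * y) \<in> borel_measurable (\<mu> \<Otimes>\<^sub>M \<nu>)"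
    by measurable
  have "(LINT z|distr (\<mu> \<Otimes>\<^sub>M \<nu>) borel (\<lambda>(x, y). x * y). h z) = (LINT y|\<nu>. LINT x|\<mu>. h (x * y))"
    if h: "continuous_on UNIV h" "bounded (range h)" for h :: "real \<Rightarrow> real"
  proof -
    have hm[measurable]: "h \<in> borel_measurable borel"
      using h(1) by (rule borel_measurable_continuous_onI)
    obtain B where B: "\<And>x. norm (h x) \<le> B"
      using h(2) by (auto simp: bounded_iff)
    have I: "integrable (\<mu> \<Otimes>\<^sub>M \<nu>) (\<lambda>(x, y). h (x * y))"
      by (rule P.P.integrable_const_bound[of _ B]) (use B in \<open>auto simp: split_beta\<close>)
    have "(LINT z|distr (\<mu> \<Otimes>\<^sub>M \<nu>) borel (\<lambda>(x, y). x * y). h z)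
        = (LINT p|(\<mu> \<Otimes>\<^sub>M \<nu>). (case p of (x, y) \<Rightarrow> h (x * y)))"
      by (subst integral_distr[OF M hm]) (simp add: case_prod_unfold)
    also have "\<dots> = (LINT y|\<nu>. LINT x|\<mu>. h (x * y))"
      using P.integral_snd[OF I] by simp
    finally show ?thesis .
  qed
  then show ?thesis
    unfolding is_mellin_convolution_def
    using P.P.real_distribution_distr[OF M] by blast
qed

lemma is_mellin_convolution_unique:
  assumes "is_mellin_convolution \<mu> \<nu> \<rho>" "is_mellin_convolution \<mu> \<nu> \<rho>'"
  shows "\<rho> = \<rho>'"
proof -
  have eq: "(LINT z|\<rho>. h z) = (LINT z|\<rho>'. h z)"
    if "continuous_on UNIV h" "bounded (range h)" for h :: "real \<Rightarrow> real"
    using assms that by (simp add: is_mellin_convolution_def)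
  interpret r: real_distribution \<rho> using assms by (simp add: is_mellin_convolution_def)
  interpret r': real_distribution \<rho>' using assms by (simp add: is_mellin_convolution_def)
  have c: "(LINT z|\<rho>. cos (t * z)) = (LINT z|\<rho>'. cos (t * z))"
    and s: "(LINT z|\<rho>. sin (t * z)) = (LINT z|\<rho>'. sin (t * z))" for t
    by (auto intro!: eq continuous_intros simp: bounded_iff intro!: exI[of _ 1])
  have chr: "char M t = Complex (LINT z|M. cos (t * z)) (LINT z|M. sin (t * z))"
    if "real_distribution M" for M t
  proof -
    interpret m: real_distribution M by fact
    have "integrable M (\<lambda>z. iexp (t * z))"
      by (rule m.integrable_const_bound[of _ 1]) auto
    then show ?thesis
      unfolding char_def complex_eq_iff by (simp add: Re_exp Im_exp flip: integral_Re integral_Im)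
  qed
  show ?thesis
    by (rule Levy_uniqueness) (auto simp: chr c s r.real_distribution_axioms r'.real_distribution_axioms)
qed

lemma mellin_convolution_eq_distr:
  assumes "real_distribution \<mu>" "real_distribution \<nu>"
  shows "mellin_convolution \<mu> \<nu> = distr (\<mu> \<Otimes>\<^sub>M \<nu>) borel (\<lambda>(x, y). x * y)"
  unfolding mellin_convolution_def
  by (rule the_equality) (use is_mellin_convolution_distr[OF assms] is_mellin_convolution_unique in blast)+

end

theory Submission
  imports Defs
begin

text \<open>
  Walk counts and moments are both multiplicative. The adjacency
  matrix of the Kronecker product graph is the Kronecker product of the two adjacency matrices,
  and since this product of matrices is multiplicative, powers are taken factor by factor
  (\<open>matrix_power_kronecker\<close>); on the diagonal this says that the walk counts multiply
  (\<open>walks_kronecker_product\<close>). On the other side, the Mellin convolution of \<open>\<mu>\<close> and \<open>\<nu>\<close> is the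
  law of the product \<open>XY\<close> of independent variables \<open>X\<close> and \<open>Y\<close> with laws \<open>\<mu>\<close> and \<open>\<nu>\<close>, and
  \<open>E[(XY)\<^sup>m] = E[X\<^sup>m] E[Y\<^sup>m]\<close>, so moments multiply as well (\<open>moment_mellin_convolution\<close>).
  Comparing the two gives the identity.

  For the equivalence between symmetry and the vanishing of odd walk counts, a symmetric
  distribution has vanishing odd moments. Conversely, any spectral distribution \<open>\<mu>\<close> can be
  symmetrized by a random sign, that is, replaced by its Mellin convolution with the uniform
  distribution on \<open>{-1, 1}\<close>. The latter has even moments \<open>1\<close> and odd moments \<open>0\<close>, so by
  multiplicativity the even moments of \<open>\<mu>\<close> stay the same, and the odd ones become zero, which
  by hypothesis they already were. The result is symmetric because a Mellin
  convolution inherits symmetry from a factor (\<open>symmetric_mellin_convolution\<close>).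
\<close>

section \<open>Walks in Kronecker products\<close>

lemma infsum_Times_mult_finite_support:
  fixes f :: "'a \<Rightarrow> real" and g :: "'b \<Rightarrow> real"
  assumes "finite {x \<in> A. f x \<noteq> 0}" "finite {y \<in> B. g y \<noteq> 0}"
  shows "(\<Sum>\<^sub>\<infinity>(x, y)\<in>A \<times> B. f x * g y) = (\<Sum>\<^sub>\<infinity>x\<in>A. f x) * (\<Sum>\<^sub>\<infinity>y\<in>B. g y)"
proof -
  define F where "F = {x \<in> A. f x \<noteq> 0}"
  define H where "H = {y \<in> B. g y \<noteq> 0}"
  have fin: "finite F" "finite H"
    using assms by (simp_all add: F_def H_def)
  have "(\<Sum>\<^sub>\<infinity>(x, y)\<in>A \<times> B. f x * g y) = (\<Sum>\<^sub>\<infinity>(x, y)\<in>F \<times> H. f x * g y)"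
    by (rule infsum_cong_neutral) (auto simp: F_def H_def)
  also have "\<dots> = (\<Sum>x\<in>F. f x) * (\<Sum>y\<in>H. g y)"
    using fin by (simp add: sum_product sum.cartesian_product)
  also have "(\<Sum>x\<in>F. f x) = (\<Sum>\<^sub>\<infinity>x\<in>F. f x)"
    using fin by simp
  also have "\<dots> = (\<Sum>\<^sub>\<infinity>x\<in>A. f x)"
    by (rule infsum_cong_neutral) (auto simp: F_def)
  also have "(\<Sum>y\<in>H. g y) = (\<Sum>\<^sub>\<infinity>y\<in>H. g y)"
    using fin by simp
  also have "\<dots> = (\<Sum>\<^sub>\<infinity>y\<in>B. g y)"
    by (rule infsum_cong_neutral) (auto simp: H_def)
  finally show ?thesis .
qed

text \<open>
  A nonzero entry of \<open>A\<^sup>m\<^sup>+\<^sup>1\<close> in row \<open>x\<close> comes from a nonzero entry in row \<open>x\<close> of \<open>A\<^sup>m\<close>, followed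
  by a nonzero entry of \<open>A\<close>, and by induction both leave finitely many choices.
\<close>

lemma finite_support_matrix_power:
  assumes A: "\<And>x. x \<in> V \<Longrightarrow> finite {y \<in> V. A x y \<noteq> 0}"
  shows "x \<in> V \<Longrightarrow> finite {y \<in> V. matrix_power V A m x y \<noteq> 0}"
proof (induction m)
  case 0
  have "{y \<in> V. matrix_power V A 0 x y \<noteq> 0} \<subseteq> {x}"
    by auto
  then show ?case
    using finite_subset by blast
next
  case (Suc m)
  let ?S = "{z \<in> V. matrix_power V A m x z \<noteq> 0}"
  have "\<exists>z\<in>?S. A z y \<noteq> 0" if "matrix_power V A (Suc m) x y \<noteq> 0" for y
  proof (rule ccontr)
    assume "\<not> ?thesis"
    then have "(\<Sum>\<^sub>\<infinity>z\<in>V. matrix_power V A m x z * A z y) = 0"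
      by (intro infsum_0) auto
    with that show False
      by simp
  qed
  then have "{y \<in> V. matrix_power V A (Suc m) x y \<noteq> 0} \<subseteq> (\<Union>z\<in>?S. {y \<in> V. A z y \<noteq> 0})"
    by blast
  moreover have "finite (\<Union>z\<in>?S. {y \<in> V. A z y \<noteq> 0})"
    using Suc A by auto
  ultimately show ?case
    by (rule finite_subset)
qed

text \<open>
  This is the mixed product rule \<open>(P \<otimes> Q)(A \<otimes> B) = PA \<otimes> QB\<close>, iterated. Since rows
  are finitely supported, only finitely many pairs of intermediate indices contribute, and the
  sum over them splits.
\<close>

lemma matrix_power_kronecker:
  assumes A: "\<And>x. x \<in> V \<Longrightarrow> finite {y \<in> V. A x y \<noteq> 0}"
    and B: "\<And>x. x \<in> W \<Longrightarrow> finite {y \<in> W. B x y \<noteq> 0}"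
    and xy: "x \<in> V" "y \<in> W"
  shows "matrix_power (V \<times> W) (\<lambda>(x, y) (x', y'). A x x' * B y y') m (x, y) (x', y')
           = matrix_power V A m x x' * matrix_power W B m y y'"
proof (induction m arbitrary: x' y')
  case 0
  show ?case by simp
next
  case (Suc m)
  have "matrix_power (V \<times> W) (\<lambda>(x, y) (x', y'). A x x' * B y y') (Suc m) (x, y) (x', y')
      = (\<Sum>\<^sub>\<infinity>(z, w)\<in>V \<times> W. (matrix_power V A m x z * A z x') * (matrix_power W B m y w * B w y'))"
    by (auto simp: Suc.IH intro!: infsum_cong)
  also have "\<dots> = (\<Sum>\<^sub>\<infinity>z\<in>V. matrix_power V A m x z * A z x')
      * (\<Sum>\<^sub>\<infinity>w\<in>W. matrix_power W B m y w * B w y')"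
  proof (rule infsum_Times_mult_finite_support)
    show "finite {z \<in> V. matrix_power V A m x z * A z x' \<noteq> 0}"
      by (rule finite_subset[OF _ finite_support_matrix_power[OF A xy(1)]]) auto
    show "finite {w \<in> W. matrix_power W B m y w * B w y' \<noteq> 0}"
      by (rule finite_subset[OF _ finite_support_matrix_power[OF B xy(2)]]) auto
  qed
  finally show ?case
    by simp
qed

lemma adj_matrix_kronecker_product:
  "adj_matrix (kronecker_product G H) = (\<lambda>(x, y) (x', y'). adj_matrix G x x' * adj_matrix H y y')"
  by (auto simp: fun_eq_iff adj_matrix_def adjacent_kronecker_product_iff)

lemma finite_support_adj_matrix:
  assumes "locally_finite_graph G" "x \<in> uverts G"
  shows "finite {y \<in> uverts G. adj_matrix G x y \<noteq> 0}"
proof -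
  have "{y \<in> uverts G. adj_matrix G x y \<noteq> 0} = {y \<in> uverts G. adjacent G x y}"
    by (auto simp: adj_matrix_def)
  with assms show ?thesis
    by (simp add: locally_finite_graph_def)
qed

theorem walks_kronecker_product:
  assumes "locally_finite_graph G" "v \<in> uverts G" "locally_finite_graph H" "w \<in> uverts H"
  shows "walks m (v, w) (kronecker_product G H) = walks m v G * walks m w H"
proof -
  have "uverts (kronecker_product G H) = uverts G \<times> uverts H"
    by (simp add: kronecker_product_def)
  then show ?thesis
    unfolding walks_def adj_matrix_kronecker_product
    using assms by (simp add: matrix_power_kronecker finite_support_adj_matrix)
qed

section \<open>Moments and symmetry of Mellin convolutions\<close>

lemma mellin_convolution_is_mellin_convolution:
  assumes "real_distribution \<mu>" "real_distribution \<nu>"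
  shows "is_mellin_convolution \<mu> \<nu> (mellin_convolution \<mu> \<nu>)"
  using is_mellin_convolution_distr[OF assms] by (simp add: mellin_convolution_eq_distr[OF assms])

lemma real_distribution_mellin_convolution:
  assumes "real_distribution \<mu>" "real_distribution \<nu>"
  shows "real_distribution (mellin_convolution \<mu> \<nu>)"
  using mellin_convolution_is_mellin_convolution[OF assms] by (simp add: is_mellin_convolution_def)

text \<open>
  Powers are unbounded, so the defining property of the Mellin convolution does not apply to
  them; the representation as the law of a product of independent variables does, once Fubini's
  theorem is justified by the integrability of both powers.
\<close>

lemma has_bochner_integral_power_mellin_convolution:
  assumes "real_distribution \<mu>" "real_distribution \<nu>" "finite_moments \<mu>" "finite_moments \<nu>"
  shows "has_bochner_integral (mellin_convolution \<mu> \<nu>) (\<lambda>z. z ^ m) (moment m \<mu> * moment m \<nu>)"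
proof -
  interpret mu: real_distribution \<mu> by fact
  interpret nu: real_distribution \<nu> by fact
  interpret P: pair_prob_space \<mu> \<nu> ..
  have int: "integrable \<mu> (\<lambda>x. x ^ m)" "integrable \<nu> (\<lambda>y. y ^ m)"
    using assms by (auto simp: finite_moments_def)
  have prod: "integrable (\<mu> \<Otimes>\<^sub>M \<nu>) (\<lambda>(x, y). x ^ m * y ^ m)"
  proof (rule P.Fubini_integrable)
    show "integrable \<mu> (\<lambda>x. \<integral>y. norm (case (x, y) of (x, y) \<Rightarrow> x ^ m * y ^ m) \<partial>\<nu>)"
      using integrable_norm[OF int(1)] by (simp add: abs_mult)
  qed (use int in auto)
  have "(\<integral>(x, y). x ^ m * y ^ m \<partial>(\<mu> \<Otimes>\<^sub>M \<nu>)) = moment m \<mu> * moment m \<nu>"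
    using P.integral_fst[OF prod] by (simp add: moment_def)
  with prod have "has_bochner_integral (\<mu> \<Otimes>\<^sub>M \<nu>) (\<lambda>p. (case p of (x, y) \<Rightarrow> x * y) ^ m)
      (moment m \<mu> * moment m \<nu>)"
    by (simp add: has_bochner_integral_iff power_mult_distrib case_prod_unfold)
  then show ?thesis
    unfolding mellin_convolution_eq_distr[OF assms(1,2)]
    by (intro has_bochner_integral_distr) auto
qed

lemma finite_moments_mellin_convolution:
  assumes "real_distribution \<mu>" "real_distribution \<nu>" "finite_moments \<mu>" "finite_moments \<nu>"
  shows "finite_moments (mellin_convolution \<mu> \<nu>)"
  using has_bochner_integral_power_mellin_convolution[OF assms]
  by (auto simp: finite_moments_def has_bochner_integral_iff)

lemma moment_mellin_convolution:
  assumes "real_distribution \<mu>" "real_distribution \<nu>" "finite_moments \<mu>" "finite_moments \<nu>"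
  shows "moment m (mellin_convolution \<mu> \<nu>) = moment m \<mu> * moment m \<nu>"
  using has_bochner_integral_power_mellin_convolution[OF assms, of m]
  by (simp add: moment_def has_bochner_integral_iff)

lemma integral_uminus_symmetric_measure:
  fixes h :: "real \<Rightarrow> real"
  assumes "symmetric_measure \<mu>" and [measurable_cong]: "sets \<mu> = sets borel"
    and [measurable]: "h \<in> borel_measurable borel"
  shows "(LINT x|\<mu>. h (- x)) = (LINT x|\<mu>. h x)"
proof -
  have "(LINT x|\<mu>. h (- x)) = (LINT x|distr \<mu> borel uminus. h x)"
    by (simp add: integral_distr)
  with assms(1) show ?thesis
    by (simp add: symmetric_measure_def)
qed

lemma odd_moment_symmetric_measure:
  assumes "symmetric_measure \<mu>" "sets \<mu> = sets borel" "odd m"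
  shows "moment m \<mu> = 0"
  using integral_uminus_symmetric_measure[OF assms(1,2), of "\<lambda>x. x ^ m"] \<open>odd m\<close>
  by (simp add: moment_def)

text \<open>
  The sign in \<open>-(xy) = x(-y)\<close> can be moved to the symmetric factor, where it does not change
  any integral. So the reflected measure satisfies the defining property of the Mellin
  convolution, which characterizes it.
\<close>

lemma symmetric_mellin_convolution:
  assumes \<mu>: "real_distribution \<mu>" and \<nu>: "real_distribution \<nu>" and sym: "symmetric_measure \<nu>"
  shows "symmetric_measure (mellin_convolution \<mu> \<nu>)"
proof -
  let ?\<rho> = "mellin_convolution \<mu> \<nu>"
  note conv = mellin_convolution_is_mellin_convolution[OF \<mu> \<nu>]
  interpret mu: real_distribution \<mu> by fact
  interpret nu: real_distribution \<nu> by fact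
  interpret rho: real_distribution ?\<rho>
    by (rule real_distribution_mellin_convolution[OF \<mu> \<nu>])
  have "is_mellin_convolution \<mu> \<nu> (distr ?\<rho> borel uminus)"
    unfolding is_mellin_convolution_def
  proof (intro conjI allI impI)
    show "real_distribution (distr ?\<rho> borel uminus)"
      by (rule rho.real_distribution_distr) auto
    fix h :: "real \<Rightarrow> real"
    assume h: "continuous_on UNIV h" "bounded (range h)"
    have [measurable]: "h \<in> borel_measurable borel"
      using h(1) by (rule borel_measurable_continuous_onI)
    have [measurable]: "(\<lambda>y. LINT x|\<mu>. h (x * y)) \<in> borel_measurable borel"
      by (rule mu.borel_measurable_lebesgue_integral) measurable
    have "(LINT z|distr ?\<rho> borel uminus. h z) = (LINT z|?\<rho>. h (- z))"
      by (simp add: integral_distr)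
    also have "\<dots> = (LINT y|\<nu>. LINT x|\<mu>. h (- (x * y)))"
    proof -
      have "continuous_on UNIV (\<lambda>z. h (- z))"
        by (intro continuous_on_compose2[OF h(1)] continuous_intros) auto
      moreover have "bounded (range (\<lambda>z. h (- z)))"
        by (rule bounded_subset[OF h(2)]) auto
      ultimately show ?thesis
        using conv by (simp add: is_mellin_convolution_def)
    qed
    also have "\<dots> = (LINT y|\<nu>. LINT x|\<mu>. h (x * (- y)))"
      by simp
    also have "\<dots> = (LINT y|\<nu>. LINT x|\<mu>. h (x * y))"
      using integral_uminus_symmetric_measure[OF sym, of "\<lambda>y. LINT x|\<mu>. h (x * y)"] by simp
    finally show "(LINT z|distr ?\<rho> borel uminus. h z) = (LINT y|\<nu>. LINT x|\<mu>. h (x * y))" .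
  qed
  from is_mellin_convolution_unique[OF this conv] show ?thesis
    by (simp add: symmetric_measure_def)
qed

section \<open>Symmetrization\<close>

text \<open>
  The push-forward only changes the \<open>\<sigma>\<close>-algebra, from the discrete one carried by a probability
  mass function to the Borel sets.
\<close>

definition random_sign :: "real measure" where
  "random_sign = distr (measure_pmf (pmf_of_set {-1, 1})) borel (\<lambda>x. x)"

lemma real_distribution_random_sign: "real_distribution random_sign"
  unfolding random_sign_def by (rule prob_space.real_distribution_distr[OF measure_pmf.prob_space_axioms]) simp

lemma finite_moments_random_sign: "finite_moments random_sign"
  unfolding finite_moments_def random_sign_def
  by (auto simp: integrable_distr_eq intro!: integrable_measure_pmf_finite)

lemma moment_random_sign: "moment m random_sign = (if even m then 1 else 0)"
  by (simp add: moment_def random_sign_def integral_distr integral_pmf_of_set)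

lemma symmetric_random_sign: "symmetric_measure random_sign"
proof -
  let ?P = "pmf_of_set {-1, 1 :: real}"
  have "map_pmf uminus ?P = ?P"
    by (subst map_pmf_of_set_inj) (auto simp: insert_commute)
  then have "random_sign = distr (measure_pmf (map_pmf uminus ?P)) borel (\<lambda>x. x)"
    by (simp only: random_sign_def)
  also have "\<dots> = distr (measure_pmf ?P) borel uminus"
    by (simp add: map_pmf_rep_eq distr_distr comp_def)
  also have "\<dots> = distr random_sign borel uminus"
    by (simp add: random_sign_def distr_distr comp_def)
  finally show ?thesis
    by (simp add: symmetric_measure_def)
qed

theorem ex_symmetric_spectral_distribution_iff:
  assumes "spectral_distribution G v \<mu>"
  shows "(\<exists>\<nu>. spectral_distribution G v \<nu> \<and> symmetric_measure \<nu>)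
    \<longleftrightarrow> (\<forall>m. walks (2 * m + 1) v G = 0)"
proof
  assume "\<exists>\<nu>. spectral_distribution G v \<nu> \<and> symmetric_measure \<nu>"
  then obtain \<nu> where \<nu>: "spectral_distribution G v \<nu>" "symmetric_measure \<nu>"
    by blast
  then interpret real_distribution \<nu>
    by (simp add: spectral_distribution_def)
  show "\<forall>m. walks (2 * m + 1) v G = 0"
    using \<nu> by (simp add: spectral_distribution_def odd_moment_symmetric_measure)
next
  assume odd: "\<forall>m. walks (2 * m + 1) v G = 0"
  let ?\<nu> = "mellin_convolution \<mu> random_sign"
  have \<mu>: "real_distribution \<mu>" "finite_moments \<mu>" "\<And>m. walks m v G = moment m \<mu>"
    using assms by (auto simp: spectral_distribution_def)
  note sign = real_distribution_random_sign finite_moments_random_sign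
  have "walks m v G = moment m ?\<nu>" for m
    using odd \<mu>(3)
    by (auto simp: moment_mellin_convolution \<mu>(1,2) sign moment_random_sign elim!: oddE)
  then have "spectral_distribution G v ?\<nu>"
    by (simp add: spectral_distribution_def real_distribution_mellin_convolution
        finite_moments_mellin_convolution \<mu>(1,2) sign)
  moreover have "symmetric_measure ?\<nu>"
    by (rule symmetric_mellin_convolution[OF \<mu>(1) sign(1) symmetric_random_sign])
  ultimately show "\<exists>\<nu>. spectral_distribution G v \<nu> \<and> symmetric_measure \<nu>"
    by blast
qed

section \<open>The spectral distribution of a Kronecker product\<close>

theorem spectral_distribution_kronecker_product:
  assumes "locally_finite_graph G" "v \<in> uverts G" "locally_finite_graph H" "w \<in> uverts H"
    and "spectral_distribution G v \<mu>" "spectral_distribution H w \<nu>"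
  shows "spectral_distribution (kronecker_product G H) (v, w) (mellin_convolution \<mu> \<nu>)"
  using assms(5,6)
  by (auto simp: spectral_distribution_def walks_kronecker_product[OF assms(1-4)]
      moment_mellin_convolution real_distribution_mellin_convolution
      finite_moments_mellin_convolution)

theorem theorem3p7:
  fixes G1 :: "'a ugraph" and G2 :: "'b ugraph"
    and o1 :: 'a and o2 :: 'b
    and \<mu>1 \<mu>2 :: "real measure"
  assumes "locally_finite_graph G1" and "o1 \<in> uverts G1"
    and "locally_finite_graph G2" and "o2 \<in> uverts G2"
    and "spectral_distribution G1 o1 \<mu>1" and "spectral_distribution G2 o2 \<mu>2"
  shows
    "((\<exists>\<nu>. spectral_distribution G1 o1 \<nu> \<and> symmetric_measure \<nu>) \<longleftrightarrow>
        (\<forall>m. walks (2 * m + 1) o1 G1 = 0)) \<and>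
     ((\<exists>\<nu>. spectral_distribution G2 o2 \<nu> \<and> symmetric_measure \<nu>) \<longleftrightarrow>
        (\<forall>m. walks (2 * m + 1) o2 G2 = 0)) \<and>
     (symmetric_measure \<mu>1 \<and> symmetric_measure \<mu>2 \<longrightarrow>
        (\<forall>m. walks m (o1, o2) (kronecker_product G1 G2)
               = moment m (mellin_convolution \<mu>1 \<mu>2)) \<and>
        spectral_distribution (kronecker_product G1 G2) (o1, o2) (mellin_convolution \<mu>1 \<mu>2))"
  using ex_symmetric_spectral_distribution_iff[OF assms(5)]
    ex_symmetric_spectral_distribution_iff[OF assms(6)]
    spectral_distribution_kronecker_product[OF assms]
  by (auto simp: spectral_distribution_def)

end
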